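(* Let $Y$ be a random variable whose moment generating function $E[e^{tY}]$ exists for $|t|<\delta$ for some $\delta>0$. Let $(Y_j)_{j\ge1}$ be mutually independent copies of $Y$, $S_0=0$, $S_k=Y_1+\cdots+Y_k$. Let $r$ be a positive integer and for $k\ge0$ define ${n+r\brace k+r}_{r,Y}$ ($n\ge k$) by $$\frac{1}{k!}\big(E[e^{tY}]-1\big)^k e^{rt}=\sum_{n=k}^{\infty}{n+r\brace k+r}_{r,Y}\frac{t^n}{n!},$$ and define $\phi^Y_{n,r}(y)=\sum_{k=0}^{n}{n+r\brace k+r}_{r,Y}y^k$. Then for all $n,j\ge0$, $$\phi^Y_{j+n,r}(y)=\sum_{l=0}^{n}\binom{n}{l}r^{n-l}\sum_{k=0}^{l}\sum_{m=0}^{j}\frac{y^k}{k!}\binom{j}{m}\sum_{l_1+\cdots+l_k=l}\binom{l}{l_1,\dots,l_k}E\Big[S_k^{j-m}\prod_{i=1}^{k}Y_i^{l_i}\Big]\phi^Y_{m,r}(y),$$ where the innermost sum runs over $k$-tuples of positive integers $(l_1,\dots,l_k)$ with $l_1+\cdots+l_k=l$.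
   Context: $E$ denotes expectation. For $k=0$ the innermost sum over compositions is the empty-tuple sum, equal to $1$ if $l=0$ and $0$ otherwise (empty product equal to $1$). *)

theory Defs
  imports "HOL-Probability.Probability"
begin

definition mom_gen :: "'a measure \<Rightarrow> ('a \<Rightarrow> real) \<Rightarrow> real \<Rightarrow> real" where
  "mom_gen M Y t = (LINT \<omega>|M. exp (t * Y \<omega>))"

(* The coefficients are those of the expansion of the generating function near t = 0, which
   determines them for n >= k.  For n < k they are set to 0, so that the sequence is unique.
   r_stirling M Y r n k stands for {n+r brace k+r}_{r,Y}: the shifts by r are not part of the
   arguments. *)
definition r_stirling :: "'a measure \<Rightarrow> ('a \<Rightarrow> real) \<Rightarrow> nat \<Rightarrow> nat \<Rightarrow> nat \<Rightarrow> real" where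
  "r_stirling M Y r n k =
     (THE a. (\<forall>i<k. a i = 0) \<and>
        (\<exists>\<epsilon>>0. \<forall>t. \<bar>t\<bar> < \<epsilon> \<longrightarrow>
           (\<lambda>i. a (k + i) * t ^ (k + i) / fact (k + i)) sums
             (1 / fact k * (mom_gen M Y t - 1) ^ k * exp (real r * t)))) n"

definition r_touchard :: "'a measure \<Rightarrow> ('a \<Rightarrow> real) \<Rightarrow> nat \<Rightarrow> nat \<Rightarrow> real \<Rightarrow> real" where
  "r_touchard M Y r n y = (\<Sum>k\<le>n. r_stirling M Y r n k * y ^ k)"

(* k-tuples (l_1, ..., l_k) of positive integers with sum l, indexed by {1..k}.  For k = 0 there
   is exactly one tuple, which has sum 0. *)
definition compositions :: "nat \<Rightarrow> nat \<Rightarrow> (nat \<Rightarrow> nat) set" where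
  "compositions k l = {ls \<in> {1..k} \<rightarrow>\<^sub>E {1..}. (\<Sum>i=1..k. ls i) = l}"

definition multinomial :: "nat \<Rightarrow> nat \<Rightarrow> (nat \<Rightarrow> nat) \<Rightarrow> real" where
  "multinomial l k ls = fact l / (\<Prod>i=1..k. fact (ls i))"

definition partial_sum :: "(nat \<Rightarrow> 'a \<Rightarrow> real) \<Rightarrow> nat \<Rightarrow> 'a \<Rightarrow> real" where
  "partial_sum Ys k \<omega> = (\<Sum>i=1..k. Ys i \<omega>)"

end

theory Submission
  imports Defs
begin

text \<open>Let $F(t) = E[e^{tY}]$.  The numbers $\phi_{n,r}(y)$ have the exponential generating function
  $\Phi(t) = e^{rt} e^{y(F(t) - 1)}$, hence
  $\Phi(t + s) = \Phi(t)\, e^{rs}\, e^{y A(s)}$ with $A(s) = F(t + s) - F(t) = E[e^{tY}(e^{sY} - 1)]$.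
  By independence $A(s)^k = E[e^{t S_k} \prod_{i \le k} (e^{s Y_i} - 1)]$, whose coefficient of $s^l t^q$
  is the sum over compositions of $l$; comparing coefficients of $s^n t^j$ gives the claim.\<close>

unbundle no vec_syntax
unbundle fps_syntax

section \<open>Taylor shift of formal power series\<close>

text \<open>The substitution $f(t) \mapsto f(t + s)$, read as a power series in $s$ whose coefficients are power
  series in $t$.\<close>

definition fps_taylor :: "'a::comm_ring_1 fps \<Rightarrow> 'a fps fps" where
  "fps_taylor f = Abs_fps (\<lambda>n. Abs_fps (\<lambda>m. of_nat ((m + n) choose n) * f $ (m + n)))"

lemma fps_taylor_nth: "fps_taylor f $ n $ m = of_nat ((m + n) choose n) * f $ (m + n)"
  by (simp add: fps_taylor_def)

lemma fps_taylor_nth_0 [simp]: "fps_taylor f $ 0 = f"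
  by (simp add: fps_eq_iff fps_taylor_nth)

lemma fps_taylor_add: "fps_taylor (f + g) = fps_taylor f + fps_taylor g"
  by (simp add: fps_eq_iff fps_taylor_nth algebra_simps)

lemma fps_taylor_const: "fps_taylor (fps_const c) = fps_const (fps_const c)"
  by (auto simp: fps_eq_iff fps_taylor_nth)

text \<open>The outer derivative is d/ds, and d/ds f(t + s) = f'(t + s). On coefficients this is the
  absorption identity (n+1) binom(m+n+1, n+1) = (m+n+1) binom(m+n, n).\<close>

lemma fps_deriv_taylor: "fps_deriv (fps_taylor f) = fps_taylor (fps_deriv f)"
proof -
  have "(of_nat (Suc n) * fps_taylor f $ Suc n) $ m = fps_taylor (fps_deriv f) $ n $ m" for n m
  proof -
    have "Suc n * ((m + Suc n) choose Suc n) = Suc (m + n) * ((m + n) choose n)"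
      using Suc_times_binomial[of n "m + n"] by simp
    then have "(of_nat (Suc n) * of_nat ((m + Suc n) choose Suc n) :: 'a)
        = of_nat (Suc (m + n)) * of_nat ((m + n) choose n)"
      by (metis of_nat_mult)
    then show ?thesis
      by (simp add: fps_taylor_nth fps_of_nat[symmetric] mult.assoc[symmetric] del: of_nat_Suc binomial_Suc_Suc)
  qed
  then show ?thesis
    by (simp add: fps_eq_iff)
qed

text \<open>Coefficients of a \<open>real fps fps\<close> are series and cannot be divided as in a
  field; cancelling positive integers suffices for recursions obtained from d/ds.\<close>

lemma fps_of_nat_mult_cancel:
  fixes f g :: "real fps"
  assumes "of_nat (Suc n) * f = of_nat (Suc n) * g"
  shows "f = g"
proof -
  have "f $ m = g $ m" for m
    using arg_cong[OF assms, of "\<lambda>h. h $ m"] by (simp add: fps_of_nat[symmetric] del: of_nat_Suc)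
  then show ?thesis by (simp add: fps_eq_iff)
qed

text \<open>The Leibniz rule reduces coefficient n + 1 for the pair f, g to coefficient n for the
  pairs f, g' and f', g. Hence the induction keeps f and g arbitrary, and no convolution of binomial
  coefficients is needed.\<close>

lemma fps_taylor_mult:
  fixes f g :: "real fps"
  shows "fps_taylor (f * g) = fps_taylor f * fps_taylor g"
proof -
  have "fps_taylor (f * g) $ n = (fps_taylor f * fps_taylor g) $ n" for n
  proof (induction n arbitrary: f g)
    case 0
    then show ?case by simp
  next
    case (Suc n)
    have "of_nat (Suc n) * fps_taylor (f * g) $ Suc n = fps_deriv (fps_taylor (f * g)) $ n"
      by simp
    also have "\<dots> = fps_taylor (f * fps_deriv g) $ n + fps_taylor (fps_deriv f * g) $ n"
      by (simp add: fps_deriv_taylor fps_taylor_add)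
    also have "\<dots> = fps_deriv (fps_taylor f * fps_taylor g) $ n"
      by (simp add: Suc fps_deriv_taylor)
    also have "\<dots> = of_nat (Suc n) * (fps_taylor f * fps_taylor g) $ Suc n"
      by (simp only: fps_deriv_nth Suc_eq_plus1)
    finally show ?case by (rule fps_of_nat_mult_cancel)
  qed
  then show ?thesis by (simp add: fps_eq_iff)
qed

section \<open>The shifted generating function via a linear differential equation\<close>

lemma fps_linear_ode_unique:
  fixes U V P :: "real fps fps"
  assumes "fps_deriv U = U * P" "fps_deriv V = V * P" "U $ 0 = V $ 0"
  shows "U = V"
proof -
  have "U $ n = V $ n" for n
  proof (induction n rule: less_induct)
    case (less n)
    show ?case
    proof (cases n)
      case 0
      then show ?thesis using assms by simp
    next
      case (Suc m)
      have "of_nat (Suc m) * U $ Suc m = (U * P) $ m"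
        using arg_cong[OF assms(1), of "\<lambda>h. h $ m"] by simp
      \<comment> \<open>The product up to degree m involves only coefficients of index at most m <
        n, which agree by induction.\<close>
      also have "\<dots> = (V * P) $ m"
        unfolding fps_mult_nth by (intro sum.cong) (auto simp: less Suc)
      also have "\<dots> = of_nat (Suc m) * V $ Suc m"
        using arg_cong[OF assms(2), of "\<lambda>h. h $ m"] by simp
      finally show ?thesis unfolding Suc by (rule fps_of_nat_mult_cancel)
    qed
  qed
  then show ?thesis by (simp add: fps_eq_iff)
qed

text \<open>$e^{cs}$ in the variable $s$ of the outer ring; \<^const>\<open>fps_exp\<close> would require a field of coefficients.\<close>

definition fps_const_exp :: "real \<Rightarrow> real fps fps" where
  "fps_const_exp c = Abs_fps (\<lambda>l. fps_const (c ^ l / fact l))"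

lemma fps_const_exp_nth [simp]: "fps_const_exp c $ l = fps_const (c ^ l / fact l)"
  by (simp add: fps_const_exp_def)

lemma fps_deriv_const_exp: "fps_deriv (fps_const_exp c) = fps_const (fps_const c) * fps_const_exp c"
proof -
  have "of_nat (Suc n) * fps_const (c ^ Suc n / fact (Suc n)) = fps_const c * fps_const (c ^ n / fact n)" for n
    by (simp add: fps_of_nat[symmetric] field_simps del: of_nat_Suc)
  then show ?thesis
    by (simp add: fps_eq_iff)
qed

text \<open>Both sides solve $U' = U \cdot (r + y F'(t + s))$ in $s$ with the same value at $s = 0$.\<close>

lemma fps_taylor_exp_compose:
  fixes F :: "real fps" and r y :: real
  assumes "F $ 0 = 1"
  defines "\<Phi> \<equiv> (fps_exp y oo (F - 1)) * fps_exp r"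
  shows "fps_taylor \<Phi> = fps_const \<Phi> * fps_const_exp r * (fps_const_exp y oo (fps_taylor F - fps_const F))"
proof (rule fps_linear_ode_unique)
  let ?A = "fps_taylor F - fps_const F"
  let ?P = "fps_const (fps_const r) + fps_const (fps_const y) * fps_taylor (fps_deriv F)"
  \<comment> \<open>The chain rule for formal composition applies because F - 1 has constant term
    0.\<close>
  have "fps_deriv \<Phi> = \<Phi> * (fps_const r + fps_const y * fps_deriv F)"
    using assms(1) by (simp add: \<Phi>_def fps_compose_deriv fps_compose_mult_distrib algebra_simps)
  then show "fps_deriv (fps_taylor \<Phi>) = fps_taylor \<Phi> * ?P"
    by (simp add: fps_deriv_taylor fps_taylor_mult fps_taylor_add fps_taylor_const)
  \<comment> \<open>\<open>fps_const F\<close> is exactly the coefficient of s^0 in F(t + s):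
    subtracting it makes the composition legitimate and does not change the derivative in s.\<close>
  have "fps_deriv (fps_const_exp y oo ?A) = (fps_const_exp y oo ?A) * (fps_const (fps_const y) * fps_taylor (fps_deriv F))"
    by (simp add: fps_compose_deriv fps_deriv_const_exp fps_deriv_taylor fps_compose_mult_distrib algebra_simps)
  then show "fps_deriv (fps_const \<Phi> * fps_const_exp r * (fps_const_exp y oo ?A))
      = fps_const \<Phi> * fps_const_exp r * (fps_const_exp y oo ?A) * ?P"
    by (simp add: fps_deriv_const_exp algebra_simps)
qed simp

section \<open>Powers of series and compositions\<close>

lemma finite_compositions: "finite (compositions k l)"
proof (rule finite_subset)
  show "compositions k l \<subseteq> {1..k} \<rightarrow>\<^sub>E {..l}"
  proof
    fix ls assume "ls \<in> compositions k l"
    then have "ls \<in> {1..k} \<rightarrow>\<^sub>E {1..}" and l: "(\<Sum>i=1..k. ls i) = l"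
      by (auto simp: compositions_def)
    moreover have "ls i \<le> l" if "i \<in> {1..k}" for i
      using member_le_sum[OF that, of ls] l by simp
    ultimately show "ls \<in> {1..k} \<rightarrow>\<^sub>E {..l}"
      by (simp add: PiE_iff)
  qed
qed (auto intro: finite_PiE)

text \<open>Expanding the power chooses one degree per factor; a zero constant term forces these
  degrees to be positive. The induction splits off the last part.\<close>

lemma fps_power_nth_compositions:
  fixes A :: "'a::comm_ring_1 fps"
  assumes "A $ 0 = 0"
  shows "(A ^ k) $ l = (\<Sum>ls\<in>compositions k l. \<Prod>i=1..k. A $ ls i)"
proof (induction k arbitrary: l)
  case 0
  have "compositions 0 l = (if l = 0 then {\<lambda>_. undefined} else {})"
    by (auto simp: compositions_def)
  then show ?case by simp
next
  case (Suc k)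
  have "(A ^ Suc k) $ l = (\<Sum>a=0..l. A $ a * (A ^ k) $ (l - a))"
    by (simp add: fps_mult_nth)
  also have "\<dots> = (\<Sum>a=1..l. A $ a * (A ^ k) $ (l - a))"
    by (intro sum.mono_neutral_right) (auto simp: not_le assms)
  also have "\<dots> = (\<Sum>(a, ls)\<in>(SIGMA a:{1..l}. compositions k (l - a)). A $ a * (\<Prod>i=1..k. A $ ls i))"
    by (simp add: Suc sum_distrib_left sum.Sigma finite_compositions)
  also have "\<dots> = (\<Sum>ls\<in>compositions (Suc k) l. \<Prod>i=1..Suc k. A $ ls i)"
  \<comment> \<open>The part a becomes the entry at \<open>Suc k\<close>. Conversely,
    \<open>restrict\<close> resets that entry to \<open>undefined\<close>, as the extensional
    function space on {1..k} demands.\<close>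
  proof (rule sum.reindex_bij_witness[where i = "\<lambda>ls. (ls (Suc k), restrict ls {1..k})"
        and j = "\<lambda>(a, ls). ls(Suc k := a)"], goal_cases)
    case (1 p)
    then show ?case
      by (auto simp: compositions_def PiE_iff extensional_def fun_eq_iff)
  next
    case (2 p)
    have "(\<Sum>i=1..k. (snd p) i) = (\<Sum>i=1..k. ((snd p)(Suc k := fst p)) i)"
      by (intro sum.cong) auto
    with 2 show ?case
      by (auto simp: compositions_def PiE_iff extensional_def)
  next
    case (3 ls)
    then show ?case
      by (auto simp: compositions_def PiE_iff extensional_def fun_eq_iff)
  next
    case (4 ls)
    then show ?case
      by (auto simp: compositions_def PiE_iff extensional_def)
  next
    case (5 p)
    have "(\<Prod>i=1..k. A $ (snd p) i) = (\<Prod>i=1..k. A $ ((snd p)(Suc k := fst p)) i)"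
      by (intro prod.cong) auto
    then show ?case
      by (cases p) (simp add: mult.commute)
  qed
  finally show ?case .
qed

section \<open>Expansions of real functions at 0\<close>

lemma powser_zero_coeffs:
  fixes a :: "nat \<Rightarrow> real"
  assumes "\<epsilon> > 0" and sums: "\<And>t. \<bar>t\<bar> < \<epsilon> \<Longrightarrow> (\<lambda>i. a i * t ^ i) sums 0"
  shows "a m = 0"
proof (induction m rule: less_induct)
  case (less m)
  have "(\<lambda>i. a (i + m) * t ^ i) sums 0" if t: "t \<noteq> 0" "\<bar>t\<bar> < \<epsilon>" for t
  proof -
    have "(\<lambda>i. a (i + m) * t ^ (i + m)) sums (0 - (\<Sum>i<m. a i * t ^ i))"
      using sums[OF t(2)] by (subst sums_iff_shift) simp
    then have "(\<lambda>i. a (i + m) * t ^ (i + m) / t ^ m) sums (0 / t ^ m)"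
      using less by (intro sums_divide) simp
    then show ?thesis using t(1) by (simp add: power_add)
  qed
  \<comment> \<open>The limit at 0 only concerns nonzero t, for which the division by t^m is
    allowed; it equals the first remaining coefficient.\<close>
  then have "((\<lambda>_. 0) \<longlongrightarrow> a (0 + m)) (at (0::real))"
    by (intro powser_limit_0_strong[OF assms(1)]) auto
  then show ?case by (metis LIM_const_eq add_0)
qed

lemma has_fps_expansionD:
  fixes f :: "real \<Rightarrow> real"
  assumes "f has_fps_expansion F"
  obtains \<epsilon> where "\<epsilon> > 0" "\<And>t. \<bar>t\<bar> < \<epsilon> \<Longrightarrow> (\<lambda>i. F $ i * t ^ i) sums f t"
proof -
  have "eventually (\<lambda>z. z \<in> eball 0 (fps_conv_radius F)) (nhds 0)"
    using assms by (intro eventually_nhds_in_open) (auto simp: has_fps_expansion_def zero_ereal_def)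
  moreover have "eventually (\<lambda>z. eval_fps F z = f z) (nhds 0)"
    using assms by (simp add: has_fps_expansion_def)
  ultimately have "eventually (\<lambda>t. (\<lambda>i. F $ i * t ^ i) sums f t) (nhds 0)"
    proof eventually_elim
    case (elim t)
    then have "summable (\<lambda>i. F $ i * t ^ i)" by (intro summable_fps) simp
    then show ?case using elim(2) by (simp add: eval_fps_def sums_iff)
  qed
  then show ?thesis
    using that by (auto simp: eventually_nhds_metric dist_real_def)
qed

lemma has_fps_expansionI:
  fixes f :: "real \<Rightarrow> real"
  assumes "\<epsilon> > 0" and sums: "\<And>t. \<bar>t\<bar> < \<epsilon> \<Longrightarrow> (\<lambda>i. F $ i * t ^ i) sums f t"
  shows "f has_fps_expansion F"
proof -
  \<comment> \<open>Any nonzero point of the interval would do; convergence at \<epsilon> / 2 bounds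
    the radius from below.\<close>
  have "fps_conv_radius F \<ge> norm (\<epsilon> / 2)"
    unfolding fps_conv_radius_def using sums[of "\<epsilon> / 2"] assms(1)
    by (intro conv_radius_geI) (auto simp: sums_iff)
  moreover have "ereal (norm (\<epsilon> / 2)) > 0" using assms(1) by simp
  ultimately have "fps_conv_radius F > 0" by order
  moreover have "eventually (\<lambda>t. eval_fps F t = f t) (nhds 0)"
    using assms unfolding eventually_nhds_metric eval_fps_def
    by (intro exI[of _ \<epsilon>]) (auto simp: dist_real_def sums_iff)
  ultimately show ?thesis by (simp add: has_fps_expansion_def)
qed

section \<open>Generating functions of the Stirling and Touchard numbers\<close>

text \<open>The definite description is resolved: the coefficients of the formal product give a
  witness, and uniqueness of convergent expansions near 0 excludes any other sequence.\<close>

lemma r_stirling_eq: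
  assumes F: "mom_gen N Y has_fps_expansion F" and F0: "F $ 0 = 1"
  shows "r_stirling N Y r n k = fact n / fact k * ((F - 1) ^ k * fps_exp (real r)) $ n"
proof -
  define H where "H = fps_const (1 / fact k) * ((F - 1) ^ k * fps_exp (real r))"
  define a where "a = (\<lambda>n. fact n * H $ n)"
  let ?f = "\<lambda>t. 1 / fact k * (mom_gen N Y t - 1) ^ k * exp (real r * t)"
  have pow: "(\<lambda>t. (mom_gen N Y t - 1) ^ k) has_fps_expansion (F - 1) ^ k" for k
    by (induction k) (auto intro!: fps_expansion_intros F)
  have "?f has_fps_expansion H"
    unfolding H_def mult.assoc by (intro fps_expansion_intros pow)
  from has_fps_expansionD[OF this] obtain \<epsilon>
    where \<epsilon>: "\<epsilon> > 0" "\<And>t. \<bar>t\<bar> < \<epsilon> \<Longrightarrow> (\<lambda>i. H $ i * t ^ i) sums ?f t"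
    by blast
  \<comment> \<open>The series (F - 1)^k has order at least k, in accordance with the convention
    that entries below k are 0.\<close>
  have H0: "H $ i = 0" if "i < k" for i
  proof -
    have "((F - 1) ^ k) $ j = 0" if "j \<le> i" for j
      using startsby_zero_power_prefix[of "F - 1" k] F0 that \<open>i < k\<close> by auto
    then show ?thesis by (simp add: H_def fps_mult_nth)
  qed
  \<comment> \<open>Leading zeros allow the series starting at index k to be read as one starting at
    0.\<close>
  have shift: "(\<lambda>i. b (k + i) * t ^ (k + i) / fact (k + i)) sums s
      \<longleftrightarrow> (\<lambda>i. (b i / fact i) * t ^ i) sums s" if "\<forall>i<k. b i = 0" for b t and s :: real
    using that sums_iff_shift[of "\<lambda>i. (b i / fact i) * t ^ i" k s]
    by (simp add: add.commute mult.commute)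
  have "r_stirling N Y r n k = a n"
    unfolding r_stirling_def
  proof (rule arg_cong[where f = "\<lambda>g. g n"], rule the_equality, goal_cases)
    case 1
    show ?case
    proof (intro conjI exI[of _ \<epsilon>] allI impI)
      show a0: "a i = 0" if "i < k" for i
        using H0 that by (simp add: a_def)
      show "(\<lambda>i. a (k + i) * t ^ (k + i) / fact (k + i)) sums ?f t" if "\<bar>t\<bar> < \<epsilon>" for t
        using \<epsilon>(2)[OF that] by (subst shift) (use a0 in \<open>auto simp: a_def\<close>)
    qed (use \<epsilon> in auto)
  next
    case (2 b)
    then obtain \<epsilon>' where b0: "\<forall>i<k. b i = 0" and \<epsilon>': "\<epsilon>' > 0"
      "\<And>t. \<bar>t\<bar> < \<epsilon>' \<Longrightarrow> (\<lambda>i. (b i / fact i) * t ^ i) sums ?f t"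
      by (auto simp: shift)
    \<comment> \<open>Both sequences expand the same function, so on the smaller interval their
      difference expands 0.\<close>
    have "b m / fact m - H $ m = 0" for m
    proof (rule powser_zero_coeffs[of "min \<epsilon> \<epsilon>'"])
      fix t :: real assume "\<bar>t\<bar> < min \<epsilon> \<epsilon>'"
      then have "(\<lambda>i. (b i / fact i) * t ^ i - H $ i * t ^ i) sums (?f t - ?f t)"
        by (intro sums_diff \<epsilon> \<epsilon>') auto
      then show "(\<lambda>i. (b i / fact i - H $ i) * t ^ i) sums 0"
        by (simp add: left_diff_distrib)
    qed (use \<epsilon> \<epsilon>' in auto)
    then show ?case by (auto simp: a_def fun_eq_iff field_simps)
  qed
  then show ?thesis by (simp add: a_def H_def)
qed

text \<open>Summing y^k (F - 1)^k / k! over k turns the column generating functions into e^{y(F -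
  1)}.\<close>

lemma r_touchard_eq:
  assumes F: "mom_gen N Y has_fps_expansion F" and F0: "F $ 0 = 1"
  shows "r_touchard N Y r n y = fact n * ((fps_exp y oo (F - 1)) * fps_exp (real r)) $ n"
proof -
  \<comment> \<open>Powers above i contribute nothing to coefficient i, so the range of k can be
    made independent of i, which permits the exchange of sums.\<close>
  have coeff: "(fps_exp y oo (F - 1)) $ i = (\<Sum>k\<le>n. y ^ k / fact k * ((F - 1) ^ k) $ i)" if "i \<le> n" for i
  proof -
    have "((F - 1) ^ k) $ i = 0" if "i < k" for k
      using startsby_zero_power_prefix[of "F - 1" k] F0 that by auto
    then show ?thesis
      unfolding fps_compose_nth using that
      by (intro sum.mono_neutral_cong_left) auto
  qed
  have "((fps_exp y oo (F - 1)) * fps_exp (real r)) $ n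
      = (\<Sum>i=0..n. \<Sum>k\<le>n. y ^ k / fact k * (((F - 1) ^ k) $ i * fps_exp (real r) $ (n - i)))"
    unfolding fps_mult_nth by (intro sum.cong refl) (simp only: coeff atLeastAtMost_iff sum_distrib_right mult.assoc)
  also have "\<dots> = (\<Sum>k\<le>n. y ^ k / fact k * ((F - 1) ^ k * fps_exp (real r)) $ n)"
    by (subst sum.swap) (simp add: fps_mult_nth sum_distrib_left)
  finally show ?thesis
    by (simp add: r_touchard_def r_stirling_eq[OF F F0] sum_distrib_left mult_ac)
qed

section \<open>Moments and the moment generating function\<close>

definition moment_fps :: "'a measure \<Rightarrow> ('a \<Rightarrow> real) \<Rightarrow> real fps" where
  "moment_fps N Y = Abs_fps (\<lambda>p. (LINT \<omega>|N. Y \<omega> ^ p) / fact p)"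

text \<open>One dominating function serves both claims: all partial sums of the series of exp |tx|
  lie below exp (tx) + exp (-tx), whose integral at x = Y is finite for |t| < \<delta>. This bounds
  each moment and justifies integrating the exponential series termwise.\<close>

lemma
  fixes Y :: "'a \<Rightarrow> real"
  assumes [measurable]: "Y \<in> borel_measurable N" and "\<delta> > 0"
    and int: "\<And>t. \<bar>t\<bar> < \<delta> \<Longrightarrow> integrable N (\<lambda>\<omega>. exp (t * Y \<omega>))"
  shows integrable_moment: "integrable N (\<lambda>\<omega>. Y \<omega> ^ p)"
    and mom_gen_expansion: "mom_gen N Y has_fps_expansion moment_fps N Y"
proof -
  have bound: "(\<Sum>i<n. \<bar>t * x\<bar> ^ i / fact i) \<le> exp (t * x) + exp (- t * x)" for t x :: real and n
  proof -
    have "(\<Sum>i<n. \<bar>t * x\<bar> ^ i / fact i) \<le> exp \<bar>t * x\<bar>"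
      using exp_converges[of "\<bar>t * x\<bar>"]
      by (intro sums_le[OF _ sums_If_finite_set[of "{..<n}" "\<lambda>i. \<bar>t * x\<bar> ^ i / fact i"], of _ "exp \<bar>t * x\<bar>"])
        (auto simp: divide_inverse mult.commute)
    also have "\<dots> \<le> exp (t * x) + exp (- t * x)"
      by (auto simp: abs_if)
    finally show ?thesis .
  qed
  have int2: "integrable N (\<lambda>\<omega>. exp (t * Y \<omega>) + exp (- t * Y \<omega>))" if "\<bar>t\<bar> < \<delta>" for t
    using int[of t] int[of "- t"] that by simp
  show integrable: "integrable N (\<lambda>\<omega>. Y \<omega> ^ p)" for p
  proof -
    \<comment> \<open>Any nonzero value of modulus below \<delta> works; the scaling by
      \<open>?t\<close> is undone afterwards.\<close>
    let ?t = "\<delta> / 2"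
    have "integrable N (\<lambda>\<omega>. (?t * Y \<omega>) ^ p / fact p)"
    proof (rule Bochner_Integration.integrable_bound[OF int2[of ?t]])
      show "AE \<omega> in N. norm ((?t * Y \<omega>) ^ p / fact p) \<le> norm (exp (?t * Y \<omega>) + exp (- ?t * Y \<omega>))"
      proof (intro always_eventually allI)
        fix \<omega>
        have "\<bar>?t * Y \<omega>\<bar> ^ p / fact p \<le> (\<Sum>i<Suc p. \<bar>?t * Y \<omega>\<bar> ^ i / fact i)"
          by (rule member_le_sum[where f = "\<lambda>i. \<bar>?t * Y \<omega>\<bar> ^ i / fact i"]) auto
        also note bound
        finally show "norm ((?t * Y \<omega>) ^ p / fact p) \<le> norm (exp (?t * Y \<omega>) + exp (- ?t * Y \<omega>))"
          by (simp add: power_abs abs_mult)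
      qed
    qed (use \<open>\<delta> > 0\<close> in auto)
    then have "integrable N (\<lambda>\<omega>. fact p / ?t ^ p * ((?t * Y \<omega>) ^ p / fact p))"
      by (rule integrable_mult_right)
    then show ?thesis
      using \<open>\<delta> > 0\<close> by (simp add: power_divide power_mult_distrib)
  qed
  show "mom_gen N Y has_fps_expansion moment_fps N Y"
  proof (rule has_fps_expansionI[OF \<open>\<delta> > 0\<close>])
    fix t :: real assume t: "\<bar>t\<bar> < \<delta>"
    let ?f = "\<lambda>p \<omega>. (t * Y \<omega>) ^ p / fact p"
    have f_int: "integrable N (?f p)" for p
      using integrable by (simp add: power_mult_distrib)
    have exp_sums: "(\<lambda>p. x ^ p / fact p) sums exp x" for x :: real
      using exp_converges[of x] by (simp add: divide_inverse mult.commute)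
    have "(\<lambda>p. integral\<^sup>L N (?f p)) sums (\<integral>\<omega>. (\<Sum>p. ?f p \<omega>) \<partial>N)"
    proof (rule sums_integral[OF f_int])
      show "AE \<omega> in N. summable (\<lambda>p. norm (?f p \<omega>))"
      proof (intro always_eventually allI)
        fix \<omega>
        show "summable (\<lambda>p. norm (?f p \<omega>))"
          using exp_sums[of "\<bar>t * Y \<omega>\<bar>"] by (simp add: power_abs sums_iff)
      qed
      show "summable (\<lambda>p. \<integral>\<omega>. norm (?f p \<omega>) \<partial>N)"
      proof (rule summableI_nonneg_bounded)
        fix n
        have "(\<Sum>p<n. \<integral>\<omega>. norm (?f p \<omega>) \<partial>N) = (\<integral>\<omega>. (\<Sum>p<n. norm (?f p \<omega>)) \<partial>N)"
          using f_int by (intro Bochner_Integration.integral_sum[symmetric] integrable_norm)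
        also have "\<dots> \<le> (\<integral>\<omega>. exp (t * Y \<omega>) + exp (- t * Y \<omega>) \<partial>N)"
          using bound[where t = t] f_int
          by (intro integral_mono int2[OF t] Bochner_Integration.integrable_sum integrable_norm)
            (simp_all add: power_abs)
        finally show "(\<Sum>p<n. \<integral>\<omega>. norm (?f p \<omega>) \<partial>N) \<le> (\<integral>\<omega>. exp (t * Y \<omega>) + exp (- t * Y \<omega>) \<partial>N)" .
      qed simp
    qed
    moreover have "integral\<^sup>L N (?f p) = moment_fps N Y $ p * t ^ p" for p
      by (simp add: moment_fps_def power_mult_distrib)
    moreover have "(\<Sum>p. ?f p \<omega>) = exp (t * Y \<omega>)" for \<omega>
      using exp_sums[of "t * Y \<omega>"] by (simp add: sums_iff)
    ultimately show "(\<lambda>p. moment_fps N Y $ p * t ^ p) sums mom_gen N Y t"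
      by (simp add: mom_gen_def)
  qed
qed

section \<open>Mixed moments of partial sums and products\<close>

text \<open>If \<mu> is the moment sequence of Y, this is the expansion in t of E[Y^l e^{tY}], the
  l-th derivative of F.\<close>

definition shifted_egf :: "(nat \<Rightarrow> real) \<Rightarrow> nat \<Rightarrow> real fps" where
  "shifted_egf \<mu> l = Abs_fps (\<lambda>q. \<mu> (q + l) / fact q)"

text \<open>The factors with index between $k + 1$ and $K$ make the induction on $k$ work: expanding
  $(S_k + Y_{k+1})^q$ only changes the exponent of the factor $Y_{k+1}$, so that independence is used for
  $k = 0$ only.\<close>

lemma (in prob_space) expectation_partial_sum_prod:
  fixes Ys :: "nat \<Rightarrow> 'a \<Rightarrow> real"
  assumes indep: "indep_vars (\<lambda>_. borel) Ys {1..}"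
    and integrable: "\<And>i p. i \<ge> 1 \<Longrightarrow> integrable M (\<lambda>\<omega>. Ys i \<omega> ^ p)"
    and moment: "\<And>i p. i \<ge> 1 \<Longrightarrow> expectation (\<lambda>\<omega>. Ys i \<omega> ^ p) = \<mu> p"
    and "k \<le> K"
  shows "has_bochner_integral M (\<lambda>\<omega>. partial_sum Ys k \<omega> ^ q * (\<Prod>i=1..K. Ys i \<omega> ^ ls i))
    (fact q * (\<Prod>i=1..k. shifted_egf \<mu> (ls i)) $ q * (\<Prod>i=Suc k..K. \<mu> (ls i)))"
  using \<open>k \<le> K\<close>
proof (induction k arbitrary: q ls)
  case 0
  have ind: "indep_vars (\<lambda>_. borel) (\<lambda>i \<omega>. Ys i \<omega> ^ ls i) {1..K}"
    by (rule indep_vars_compose2[OF indep_vars_subset[OF indep]]) auto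
  have "has_bochner_integral M (\<lambda>\<omega>. \<Prod>i=1..K. Ys i \<omega> ^ ls i) (\<Prod>i=1..K. \<mu> (ls i))"
    unfolding has_bochner_integral_iff
    using indep_vars_lebesgue_integral[OF _ ind] indep_vars_integrable[OF _ ind]
    by (simp add: integrable moment)
  \<comment> \<open>For q > 0 both sides vanish: S_0 = 0, and the empty product is the series 1,
    whose coefficient of degree q is 0.\<close>
  then show ?case
    by (cases q) (simp_all add: partial_sum_def has_bochner_integral_zero)
next
  case (Suc k)
  \<comment> \<open>The exponents after Y_{k+1}^{q-a} from the binomial expansion has been absorbed
    into the product.\<close>
  let ?ls = "\<lambda>a. ls(Suc k := (q - a) + ls (Suc k))"
  let ?P = "\<Prod>i=1..k. shifted_egf \<mu> (ls i)"
  let ?Q = "\<Prod>i=Suc (Suc k)..K. \<mu> (ls i)"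
  have eq: "partial_sum Ys (Suc k) \<omega> ^ q * (\<Prod>i=1..K. Ys i \<omega> ^ ls i)
    = (\<Sum>a\<le>q. real (q choose a) * (partial_sum Ys k \<omega> ^ a * (\<Prod>i=1..K. Ys i \<omega> ^ ?ls a i)))" for \<omega>
  proof -
    have upd: "(\<Prod>i=1..K. Ys i \<omega> ^ ?ls a i) = Ys (Suc k) \<omega> ^ (q - a) * (\<Prod>i=1..K. Ys i \<omega> ^ ls i)" for a
    proof -
      have "(\<Prod>i\<in>{1..K} - {Suc k}. Ys i \<omega> ^ ?ls a i) = (\<Prod>i\<in>{1..K} - {Suc k}. Ys i \<omega> ^ ls i)"
        by (intro prod.cong) auto
      moreover have "finite {1..K}" "Suc k \<in> {1..K}"
        using Suc.prems by auto
      ultimately show ?thesis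
        by (simp only: prod.remove fun_upd_same power_add mult.assoc)
    qed
    have "partial_sum Ys (Suc k) \<omega> ^ q
      = (\<Sum>a\<le>q. real (q choose a) * partial_sum Ys k \<omega> ^ a * Ys (Suc k) \<omega> ^ (q - a))"
      by (simp add: partial_sum_def binomial_ring)
    then show ?thesis
      by (simp only: upd sum_distrib_right mult.assoc)
  qed
  \<comment> \<open>The update touches only index k + 1, which for the induction hypothesis at k is
    still the first factor of the tail.\<close>
  have val: "fact a * (\<Prod>i=1..k. shifted_egf \<mu> (?ls a i)) $ a * (\<Prod>i=Suc k..K. \<mu> (?ls a i))
    = fact a * ?P $ a * (\<mu> ((q - a) + ls (Suc k)) * ?Q)" for a
  proof -
    have "(\<Prod>i=1..k. shifted_egf \<mu> (?ls a i)) = ?P"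
      by (intro prod.cong) auto
    moreover have "(\<Prod>i=Suc (Suc k)..K. \<mu> (?ls a i)) = ?Q"
      by (intro prod.cong) auto
    ultimately show ?thesis
      using Suc.prems by (simp add: prod.atLeast_Suc_atMost del: fun_upd_apply) simp
  qed
  have "has_bochner_integral M (\<lambda>\<omega>. partial_sum Ys (Suc k) \<omega> ^ q * (\<Prod>i=1..K. Ys i \<omega> ^ ls i))
    (\<Sum>a\<le>q. real (q choose a) * (fact a * ?P $ a * (\<mu> ((q - a) + ls (Suc k)) * ?Q)))"
    unfolding eq using Suc.IH[of _ "?ls _"] Suc.prems
    by (intro has_bochner_integral_sum has_bochner_integral_mult_right) (simp only: val[symmetric] Suc_leD)
  moreover have "(\<Sum>a\<le>q. real (q choose a) * (fact a * ?P $ a * (\<mu> ((q - a) + ls (Suc k)) * ?Q)))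
    = fact q * (\<Prod>i=1..Suc k. shifted_egf \<mu> (ls i)) $ q * ?Q"
  \<comment> \<open>Since binom(q, a) a! = q! / (q - a)!, the sum over a is q! times the Cauchy
    product with the new factor.\<close>
  proof -
    have "(\<Prod>i=1..Suc k. shifted_egf \<mu> (ls i)) = ?P * shifted_egf \<mu> (ls (Suc k))"
      by (simp add: mult.commute)
    then have "(\<Prod>i=1..Suc k. shifted_egf \<mu> (ls i)) $ q
        = (\<Sum>a\<le>q. ?P $ a * (\<mu> ((q - a) + ls (Suc k)) / fact (q - a)))"
      by (simp only: fps_mult_nth atMost_atLeast0) (simp add: shifted_egf_def)
    then show ?thesis
      by (simp only: sum_distrib_left sum_distrib_right, intro sum.cong refl)
        (simp add: binomial_fact field_simps)
  qed
  ultimately show ?case by simp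
qed

section \<open>Comparison of coefficients\<close>

text \<open>By Taylor's formula the coefficient of s^l in F(t + s) is F^(l)(t) / l!, and l
  derivatives shift the moment sequence by l.\<close>

lemma fps_taylor_moment:
  "fps_const (fact l) * fps_taylor (moment_fps N Y) $ l = shifted_egf (\<lambda>p. LINT \<omega>|N. Y \<omega> ^ p) l"
  by (simp add: fps_eq_iff fps_taylor_nth moment_fps_def shifted_egf_def binomial_fact)

theorem theorem2p7:
  fixes N :: "'b measure" and Y :: "'b \<Rightarrow> real"
    and M :: "'a measure" and Ys :: "nat \<Rightarrow> 'a \<Rightarrow> real"
    and \<delta> y :: real and r n j :: nat
  assumes "prob_space N"
    and "Y \<in> borel_measurable N"
    and "\<delta> > 0"
    and "\<And>t. \<bar>t\<bar> < \<delta> \<Longrightarrow> integrable N (\<lambda>\<omega>. exp (t * Y \<omega>))"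
    and "prob_space M"
    and "prob_space.indep_vars M (\<lambda>_. borel) Ys {1..}"
    and "\<And>i. i \<ge> 1 \<Longrightarrow> distr M borel (Ys i) = distr N borel Y"
    and "r > 0"
  shows "r_touchard N Y r (j + n) y =
    (\<Sum>l\<le>n. real (n choose l) * real r ^ (n - l) *
      (\<Sum>k\<le>l. \<Sum>m\<le>j. y ^ k / fact k * real (j choose m) *
        (\<Sum>ls\<in>compositions k l. multinomial l k ls *
          (LINT \<omega>|M. partial_sum Ys k \<omega> ^ (j - m) * (\<Prod>i=1..k. Ys i \<omega> ^ ls i))) *
        r_touchard N Y r m y))"
proof -
  interpret N: prob_space N by fact
  interpret M: prob_space M by fact
  let ?\<mu> = "\<lambda>p. LINT \<omega>|N. Y \<omega> ^ p"
  define F where "F = moment_fps N Y"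
  define A where "A = fps_taylor F - fps_const F"
  define \<Phi> where "\<Phi> = (fps_exp y oo (F - 1)) * fps_exp (real r)"
  have Y_int: "integrable N (\<lambda>\<omega>. Y \<omega> ^ p)" for p
    by (rule integrable_moment[OF assms(2-4)])
  have F0: "F $ 0 = 1"
    by (simp add: F_def moment_fps_def N.prob_space)
  have touchard: "r_touchard N Y r p y = fact p * \<Phi> $ p" for p
    unfolding \<Phi>_def F_def
    using r_touchard_eq[OF mom_gen_expansion[OF assms(2-4)]] F0 by (simp add: F_def)
  have Ys_meas: "Ys i \<in> borel_measurable M" if "i \<ge> 1" for i
    using assms(6) that by (auto simp: M.indep_vars_def)
  \<comment> \<open>Integrability and moments depend only on the law, so both are transported from Y
    through the common distribution.\<close>
  have Ys_int: "integrable M (\<lambda>\<omega>. Ys i \<omega> ^ p)" if "i \<ge> 1" for i p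
    using Y_int[of p] integrable_distr_eq[OF Ys_meas[OF that], of "\<lambda>x. x ^ p"]
      integrable_distr_eq[OF assms(2), of "\<lambda>x. x ^ p"] assms(7)[OF that] by simp
  have Ys_moment: "(LINT \<omega>|M. Ys i \<omega> ^ p) = ?\<mu> p" if "i \<ge> 1" for i p
    using integral_distr[OF Ys_meas[OF that], of "\<lambda>x. x ^ p"]
      integral_distr[OF assms(2), of "\<lambda>x. x ^ p"] assms(7)[OF that] by simp
  have comp_sum: "(\<Sum>ls\<in>compositions k l. multinomial l k ls *
      (LINT \<omega>|M. partial_sum Ys k \<omega> ^ q * (\<Prod>i=1..k. Ys i \<omega> ^ ls i)))
    = fact l * fact q * ((A ^ k) $ l) $ q" for k l q
  proof -
    have "multinomial l k ls * (LINT \<omega>|M. partial_sum Ys k \<omega> ^ q * (\<Prod>i=1..k. Ys i \<omega> ^ ls i))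
      = fact l * fact q * (\<Prod>i=1..k. A $ ls i) $ q" if "ls \<in> compositions k l" for ls
    proof -
      \<comment> \<open>Positivity of the parts matters: A differs from F(t + s) only in the
        coefficient of s^0.\<close>
      have "A $ ls i = fps_const (1 / fact (ls i)) * shifted_egf ?\<mu> (ls i)" if "i \<in> {1..k}" for i
      proof -
        have "ls i \<ge> 1"
          using \<open>ls \<in> compositions k l\<close> that by (auto simp: compositions_def PiE_iff)
        then show ?thesis
          by (simp add: fps_taylor_moment[symmetric] A_def F_def mult.assoc[symmetric])
      qed
      then have "(\<Prod>i=1..k. A $ ls i)
          = (\<Prod>i=1..k. fps_const (1 / fact (ls i))) * (\<Prod>i=1..k. shifted_egf ?\<mu> (ls i))"
        by (simp add: prod.distrib)
      also have "(\<Prod>i=1..k. fps_const (1 / fact (ls i) :: real)) = fps_const (1 / (\<Prod>i=1..k. fact (ls i)))"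
        by (induction k) (simp_all add: mult.commute)
      \<comment> \<open>With K = k no tail factors remain.\<close>
      finally show ?thesis
        using M.expectation_partial_sum_prod[OF assms(6) Ys_int Ys_moment order_refl, of k q ls]
        by (simp add: has_bochner_integral_iff multinomial_def)
    qed
    moreover have "A $ 0 = 0" by (simp add: A_def)
    ultimately show ?thesis
      by (simp add: fps_power_nth_compositions fps_sum_nth sum_distrib_left)
  qed
  have "fps_taylor \<Phi> $ n = (fps_const \<Phi> * (fps_const_exp (real r) * (fps_const_exp y oo A))) $ n"
    unfolding \<Phi>_def A_def by (subst fps_taylor_exp_compose[OF F0]) (simp only: mult.assoc)
  also have "\<dots> = \<Phi> * (\<Sum>l\<le>n. (\<Sum>k\<le>l. fps_const (y ^ k / fact k) * (A ^ k) $ l)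
      * fps_const (real r ^ (n - l) / fact (n - l)))"
    \<comment> \<open>After the swap the Cauchy product is indexed by the degree l of the
      exponential in A, leaving degree n - l for e^{rs}, as in the claim.\<close>
    by (subst mult.commute[of "fps_const_exp (real r)"])
      (simp add: fps_mult_nth[of "fps_const_exp y oo A"] fps_compose_nth atMost_atLeast0)
  also have "\<dots> = (\<Sum>l\<le>n. fps_const (real r ^ (n - l) / fact (n - l)) *
      (\<Sum>k\<le>l. fps_const (y ^ k / fact k) * (\<Phi> * (A ^ k) $ l)))"
    by (simp add: sum_distrib_left sum_distrib_right mult_ac)
  finally have key: "fps_taylor \<Phi> $ n $ j = (\<Sum>l\<le>n. real r ^ (n - l) / fact (n - l) *
      (\<Sum>k\<le>l. y ^ k / fact k * (\<Phi> * (A ^ k) $ l) $ j))"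
    by (simp add: fps_sum_nth)
  \<comment> \<open>As binom(j, m) (j - m)! m! = j!, the sum over m is the coefficient of t^j in a
    product.\<close>
  have conv: "(\<Sum>m\<le>j. y ^ k / fact k * real (j choose m) *
      (fact l * fact (j - m) * ((A ^ k) $ l) $ (j - m)) * (fact m * \<Phi> $ m))
    = fact l * fact j * (y ^ k / fact k * (\<Phi> * (A ^ k) $ l) $ j)" for k l
    by (simp add: fps_mult_nth sum_distrib_left atMost_atLeast0 binomial_fact field_simps)
  \<comment> \<open>Here (j + n)! = n! j! binom(j + n, n), and the binomial is the weight built into
    \<open>fps_taylor\<close>.\<close>
  have "r_touchard N Y r (j + n) y = fact n * fact j * fps_taylor \<Phi> $ n $ j"
    by (simp add: touchard fps_taylor_nth binomial_fact)
  also have "\<dots> = (\<Sum>l\<le>n. real (n choose l) * real r ^ (n - l) *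
      (\<Sum>k\<le>l. fact l * fact j * (y ^ k / fact k * (\<Phi> * (A ^ k) $ l) $ j)))"
    unfolding key sum_distrib_left
    by (intro sum.cong refl) (simp add: binomial_fact field_simps)
  finally show ?thesis
    unfolding comp_sum touchard conv .
qed

end
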